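(* For all $\Gamma\subseteq\mathsf{Form}$ and $\varphi\in\mathsf{Form}$: (1) $\Gamma\vdash_{\mathsf T}\varphi$ if and only if $\Gamma\vDash_{\mathsf C_{\mathsf T}}\varphi$; (2) $\Gamma\vdash_{\mathsf F}\varphi$ if and only if $\Gamma\vDash_{\mathsf C_{\mathsf F}}\varphi$.
   Context: **Language.** $\mathsf{Prop}$ is a countable set of propositional variables; $\mathsf{Form}$ is generated by $\varphi::=p\mid\bot\mid\top\mid(\varphi\wedge\varphi)\mid(\varphi\vee\varphi)\mid(\varphi\to\varphi)$, $p\in\mathsf{Prop}$, and $\neg\alpha:=\alpha\to\bot$. **Systems.** For relations ${\vdash}\subseteq\wp(\mathsf{Form})\times\mathsf{Form}$ write $\Gamma,\varphi\vdash\psi$ for $\Gamma\cup\{\varphi\}\vdash\psi$, $\varphi\vdash\psi$ for $\{\varphi\}\vdash\psi$, $\vdash\varphi$ for $\varnothing\vdash\varphi$, and $\alpha\dashv\vdash\beta$ for $\alpha\vdash\beta$ and $\beta\vdash\alpha$. The *$\mathsf K$-conditions* are, for all sets $\Gamma,\Delta$ and formulas: (A) $\Gamma,\varphi\vdash\varphi$; (Cut) if $\Gamma,\psi\vdash\varphi$ and $\Delta\vdash\psi$ then $\Gamma\cup\Delta\vdash\varphi$; ($\wedge$I) $\{\varphi,\psi\}\vdash\varphi\wedge\psi$; ($\wedge$E) $\varphi\wedge\psi\vdash\varphi$ and $\varphi\wedge\psi\vdash\psi$; ($\vee$I) $\varphi\vdash\varphi\vee\psi$ and $\psi\vdash\varphi\vee\psi$;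 ($\vee$E) if $\varphi\vdash\alpha$ and $\psi\vdash\alpha$ then $\varphi\vee\psi\vdash\alpha$; ($\bot$E) $\bot\vdash\varphi$; ($\top$) $\vdash\top$; ($\top\to$E) $\top\to\varphi\vdash\varphi$; (Con) if $\alpha\wedge\beta\vdash\psi$ then $\alpha\to\beta\vdash\alpha\to\psi$; ($\wedge{\vdash}\to$) $\alpha\wedge\beta\vdash\alpha\to\beta$; (Imp) if $\alpha\wedge\beta\vdash\varphi$ then $\varphi\to(\alpha\to\beta)\vdash(\varphi\wedge\alpha)\to\beta$; (Rep) if $\alpha\dashv\vdash\alpha'$ then $\alpha\to\beta\dashv\vdash\alpha'\to\beta$. $\vdash_{\mathsf T}$ is the smallest relation satisfying the $\mathsf K$-conditions together with ($\to$Id) $\vdash\alpha\to\alpha$ and (Exp) $\{\alpha,\neg\alpha\}\vdash\bot$. $\vdash_{\mathsf F}$ is the smallest relation satisfying all of these together with ($\neg\neg$I) $\alpha\vdash\neg\neg\alpha$. **Relational semantics.** A *relational frame* is $(X,\lhd)$ with $X\neq\varnothing$ and $\lhd$ a binary relation on $X$. For $U,V\subseteq X$: $\Box U=\{x\mid\forall y\,(y\lhd x\Rightarrow y\in U)\}$, $c_\lhd(U)=\{x\mid\forall y\,(y\lhd x\Rightarrow\exists z\,(y\lhd z\text{ and }z\in U))\}$, and $U\to_\lhd V=\{x\mid\forall y\,((y\lhd x\text{ and }y\in U)\Rightarrow\exists z\,(y\lhd z\text{ and }z\in U\cap V))\}$. A *proposition* is a fixpoint of $c_\lhd$; $\chi_\lhd(X)$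 is the set of propositions. $y$ *prerefines* $x$ if for all $z$, $z\lhd y$ implies $z\lhd x$. The frame is *reflexive* if $x\lhd x$ for all $x$, and *pseudo-symmetric* if for all $x$ and all $y\lhd x$ there is $z\lhd y$ such that $z$ prerefines $x$. An *$\mathsf F$-frame* is a reflexive, pseudo-symmetric frame. A *model* is $\mathcal M=(X,\lhd,V)$ with $(X,\lhd)$ a relational frame and $V:\mathsf{Prop}\to\chi_\lhd(X)$. Truth sets: $\lVert p\rVert=V(p)$, $\lVert\top\rVert=X$, $\lVert\bot\rVert=\Box\varnothing$, $\lVert\alpha\wedge\beta\rVert=\lVert\alpha\rVert\cap\lVert\beta\rVert$, $\lVert\alpha\vee\beta\rVert=c_\lhd(\lVert\alpha\rVert\cup\lVert\beta\rVert)$, $\lVert\alpha\to\beta\rVert=\lVert\alpha\rVert\to_\lhd\lVert\beta\rVert$. $\mathcal M,x\vDash\varphi$ means $x\in\lVert\varphi\rVert$. For a class $\mathsf C$ of models, $\Gamma\vDash_{\mathsf C}\varphi$ means: for all $\mathcal M\in\mathsf C$ and all states $x$ of $\mathcal M$, if $\mathcal M,x\vDash\gamma$ for all $\gamma\in\Gamma$ then $\mathcal M,x\vDash\varphi$. $\mathsf C_{\mathsf T}$ is the class of models over reflexive frames; $\mathsf C_{\mathsf F}$ is the class of models over $\mathsf F$-frames. *)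

theory Defs
  imports "HOL-Library.Countable"
begin

section \<open>Language\<close>

datatype 'p form =
    Var 'p
  | Bot  ("\<^bold>\<bottom>")
  | Top  ("\<^bold>\<top>")
  | Conj "'p form" "'p form"  (infixr "\<^bold>\<and>" 58)
  | Disj "'p form" "'p form"  (infixr "\<^bold>\<or>" 57)
  | Cond "'p form" "'p form"  (infixr "\<^bold>\<rightarrow>" 56)

abbreviation Neg :: "'p form \<Rightarrow> 'p form"  ("\<^bold>\<not> _" [60] 60)
  where "\<^bold>\<not> \<alpha> \<equiv> \<alpha> \<^bold>\<rightarrow> \<^bold>\<bottom>"

section \<open>Systems\<close>

text \<open>
  \<open>derives S\<close> is the smallest relation that satisfies the K-conditions and contains all
  pairs in \<open>S\<close>. The conditions that distinguish the systems below have no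
  premises, so each of them is such a set of pairs (closed under instances).
\<close>

inductive derives :: "('p form set \<times> 'p form) set \<Rightarrow> 'p form set \<Rightarrow> 'p form \<Rightarrow> bool"
  for S :: "('p form set \<times> 'p form) set"
where
  extra: "(\<Gamma>, \<phi>) \<in> S \<Longrightarrow> derives S \<Gamma> \<phi>"
| A: "derives S (\<Gamma> \<union> {\<phi>}) \<phi>"
| Cut: "derives S (\<Gamma> \<union> {\<psi>}) \<phi> \<Longrightarrow> derives S \<Delta> \<psi> \<Longrightarrow> derives S (\<Gamma> \<union> \<Delta>) \<phi>"
| ConjI: "derives S {\<phi>, \<psi>} (\<phi> \<^bold>\<and> \<psi>)"
| ConjE1: "derives S {\<phi> \<^bold>\<and> \<psi>} \<phi>"
| ConjE2: "derives S {\<phi> \<^bold>\<and> \<psi>} \<psi>"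
| DisjI1: "derives S {\<phi>} (\<phi> \<^bold>\<or> \<psi>)"
| DisjI2: "derives S {\<psi>} (\<phi> \<^bold>\<or> \<psi>)"
| DisjE: "derives S {\<phi>} \<alpha> \<Longrightarrow> derives S {\<psi>} \<alpha> \<Longrightarrow> derives S {\<phi> \<^bold>\<or> \<psi>} \<alpha>"
| BotE: "derives S {\<^bold>\<bottom>} \<phi>"
| TopI: "derives S {} \<^bold>\<top>"
| TopCondE: "derives S {\<^bold>\<top> \<^bold>\<rightarrow> \<phi>} \<phi>"
| Con: "derives S {\<alpha> \<^bold>\<and> \<beta>} \<psi> \<Longrightarrow> derives S {\<alpha> \<^bold>\<rightarrow> \<beta>} (\<alpha> \<^bold>\<rightarrow> \<psi>)"
| ConjCond: "derives S {\<alpha> \<^bold>\<and> \<beta>} (\<alpha> \<^bold>\<rightarrow> \<beta>)"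
| Imp: "derives S {\<alpha> \<^bold>\<and> \<beta>} \<phi> \<Longrightarrow>
    derives S {\<phi> \<^bold>\<rightarrow> (\<alpha> \<^bold>\<rightarrow> \<beta>)} ((\<phi> \<^bold>\<and> \<alpha>) \<^bold>\<rightarrow> \<beta>)"
| Rep: "derives S {\<alpha>} \<alpha>' \<Longrightarrow> derives S {\<alpha>'} \<alpha> \<Longrightarrow>
    derives S {\<alpha> \<^bold>\<rightarrow> \<beta>} (\<alpha>' \<^bold>\<rightarrow> \<beta>)"
  \<comment> \<open>the converse entailment is the instance with \<open>\<alpha>\<close> and \<open>\<alpha>'\<close> swapped\<close>

definition CondId :: "('p form set \<times> 'p form) set"
  where "CondId = {({}, \<alpha> \<^bold>\<rightarrow> \<alpha>) | \<alpha>. True}"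

definition Exp :: "('p form set \<times> 'p form) set"
  where "Exp = {({\<alpha>, \<^bold>\<not> \<alpha>}, \<^bold>\<bottom>) | \<alpha>. True}"

definition NegNegI :: "('p form set \<times> 'p form) set"
  where "NegNegI = {({\<alpha>}, \<^bold>\<not> \<^bold>\<not> \<alpha>) | \<alpha>. True}"

definition derives_T :: "'p form set \<Rightarrow> 'p form \<Rightarrow> bool"  (infix "\<turnstile>\<^sub>T" 50)
  where "\<Gamma> \<turnstile>\<^sub>T \<phi> \<longleftrightarrow> derives (CondId \<union> Exp) \<Gamma> \<phi>"

definition derives_F :: "'p form set \<Rightarrow> 'p form \<Rightarrow> bool"  (infix "\<turnstile>\<^sub>F" 50)
  where "\<Gamma> \<turnstile>\<^sub>F \<phi> \<longleftrightarrow> derives (CondId \<union> Exp \<union> NegNegI) \<Gamma> \<phi>"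

section \<open>Relational semantics\<close>

text \<open>In a frame \<open>(X, R)\<close>, \<open>(y, x) \<in> R\<close> stands for \<open>y \<lhd> x\<close>.\<close>

definition relational_frame :: "'x set \<Rightarrow> 'x rel \<Rightarrow> bool"
  where "relational_frame X R \<longleftrightarrow> X \<noteq> {} \<and> R \<subseteq> X \<times> X"

definition box :: "'x set \<Rightarrow> 'x rel \<Rightarrow> 'x set \<Rightarrow> 'x set"
  where "box X R U = {x \<in> X. \<forall>y. (y, x) \<in> R \<longrightarrow> y \<in> U}"

definition cl :: "'x set \<Rightarrow> 'x rel \<Rightarrow> 'x set \<Rightarrow> 'x set"
  where "cl X R U = {x \<in> X. \<forall>y. (y, x) \<in> R \<longrightarrow> (\<exists>z. (y, z) \<in> R \<and> z \<in> U)}"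

definition cond :: "'x set \<Rightarrow> 'x rel \<Rightarrow> 'x set \<Rightarrow> 'x set \<Rightarrow> 'x set"
  where "cond X R U V =
    {x \<in> X. \<forall>y. (y, x) \<in> R \<and> y \<in> U \<longrightarrow> (\<exists>z. (y, z) \<in> R \<and> z \<in> U \<inter> V)}"

definition propositions :: "'x set \<Rightarrow> 'x rel \<Rightarrow> 'x set set"
  where "propositions X R = {U. U \<subseteq> X \<and> cl X R U = U}"

definition prerefines :: "'x rel \<Rightarrow> 'x \<Rightarrow> 'x \<Rightarrow> bool"
  where "prerefines R y x \<longleftrightarrow> (\<forall>z. (z, y) \<in> R \<longrightarrow> (z, x) \<in> R)"

text \<open>
  \<open>z\<close> and \<open>y\<close> range over \<open>X\<close> because \<open>R \<subseteq> X \<times> X\<close> in a relational frame.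
\<close>

definition pseudo_symmetric :: "'x set \<Rightarrow> 'x rel \<Rightarrow> bool"
  where "pseudo_symmetric X R \<longleftrightarrow>
    (\<forall>x\<in>X. \<forall>y. (y, x) \<in> R \<longrightarrow> (\<exists>z. (z, y) \<in> R \<and> prerefines R z x))"

definition F_frame :: "'x set \<Rightarrow> 'x rel \<Rightarrow> bool"
  where "F_frame X R \<longleftrightarrow> relational_frame X R \<and> refl_on X R \<and> pseudo_symmetric X R"

record ('x, 'p) model =
  states :: "'x set"
  rel :: "'x rel"
  val :: "'p \<Rightarrow> 'x set"

definition is_model :: "('x, 'p) model \<Rightarrow> bool"
  where "is_model M \<longleftrightarrow> relational_frame (states M) (rel M) \<and>
    (\<forall>p. val M p \<in> propositions (states M) (rel M))"

primrec truth_set :: "('x, 'p) model \<Rightarrow> 'p form \<Rightarrow> 'x set"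
where
  "truth_set M (Var p) = val M p"
| "truth_set M \<^bold>\<bottom> = box (states M) (rel M) {}"
| "truth_set M \<^bold>\<top> = states M"
| "truth_set M (\<alpha> \<^bold>\<and> \<beta>) = truth_set M \<alpha> \<inter> truth_set M \<beta>"
| "truth_set M (\<alpha> \<^bold>\<or> \<beta>) = cl (states M) (rel M) (truth_set M \<alpha> \<union> truth_set M \<beta>)"
| "truth_set M (\<alpha> \<^bold>\<rightarrow> \<beta>) = cond (states M) (rel M) (truth_set M \<alpha>) (truth_set M \<beta>)"

definition sat :: "('x, 'p) model \<Rightarrow> 'x \<Rightarrow> 'p form \<Rightarrow> bool"
  where "sat M x \<phi> \<longleftrightarrow> x \<in> truth_set M \<phi>"

definition entails :: "('x, 'p) model set \<Rightarrow> 'p form set \<Rightarrow> 'p form \<Rightarrow> bool"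
  where "entails C \<Gamma> \<phi> \<longleftrightarrow>
    (\<forall>M\<in>C. \<forall>x\<in>states M. (\<forall>\<gamma>\<in>\<Gamma>. sat M x \<gamma>) \<longrightarrow> sat M x \<phi>)"

text \<open>
  The classes below consist of the models whose set of states is any nonempty subset of the
  type \<open>'x\<close>. HOL cannot quantify over types inside a formula, so theorems about them
  are stated for an arbitrary type \<open>'x\<close>. When \<open>'x\<close> is infinite, every
  finite or countable model has an isomorphic copy in them.
\<close>

definition C_T :: "('x, 'p) model set"
  where "C_T = {M. is_model M \<and> refl_on (states M) (rel M)}"

definition C_F :: "('x, 'p) model set"
  where "C_F = {M. is_model M \<and> F_frame (states M) (rel M)}"

end

theory Submission
  imports Defs "HOL-Library.Countable_Set"
begin

text \<open>
  Soundness is an induction on derivations: truth sets are fixpoints of the closure operator, and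
  each rule is an inclusion between such fixpoints (lemma \<open>derives_sound\<close>). Reflexivity of the
  frame validates \<open>CondId\<close> and \<open>Exp\<close>. For \<open>NegNegI\<close>, if \<open>x\<close> satisfies \<open>\<alpha>\<close> and \<open>y \<lhd> x\<close>, then
  pseudo-symmetry gives some \<open>z \<lhd> y\<close> that prerefines \<open>x\<close>; such a \<open>z\<close> satisfies \<open>\<alpha>\<close> too, so that
  \<open>y\<close> cannot satisfy \<open>\<^bold>\<not> \<alpha>\<close>.

  For completeness, a canonical state is a pair \<open>(G, J)\<close>: it accepts what \<open>G\<close> derives and rejects
  \<open>J\<close>. A state \<open>t\<close> is open to \<open>s\<close>, written \<open>t \<lhd> s\<close>, if \<open>s\<close> accepts nothing that \<open>t\<close> rejects. The
  truth lemma, that a formula is true exactly where it is accepted, rests on two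
  requirements. First, each state has to be \<open>coherent\<close>; in particular \<open>J\<close> is directed (for
  disjunctions), and a state that accepts \<open>\<alpha>\<close> and rejects \<open>\<alpha> \<^bold>\<and> \<beta>\<close> also rejects \<open>\<alpha> \<^bold>\<rightarrow> \<beta>\<close> (for
  conditionals). Secondly, there have to be enough states, and the pairs
  \<open>({\<alpha>}, {\<alpha> \<^bold>\<rightarrow> \<beta>})\<close> suffice: such a pair witnesses the failure of \<open>\<alpha> \<^bold>\<rightarrow> \<beta>\<close> wherever
  that is not accepted.

  These pairs handle only finite premise sets. For an arbitrary consistent \<open>\<Gamma>\<close>, the pair of \<open>\<Gamma>\<close>
  and \<open>{\<^bold>\<not> \<alpha> | \<alpha>. \<Gamma> \<turnstile> \<alpha>}\<close> is coherent as well, and pairs of this form also make the frame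
  pseudo-symmetric in the presence of \<open>NegNegI\<close>. So \<open>\<Gamma>\<close> and the formulas themselves yield all
  states that are needed; there are only countably many of them, and an infinite type of states
  can be mapped onto them. Since the frame relation and the valuation depend only on the pair,
  several states may carry the same pair.
\<close>

section \<open>Soundness\<close>

lemma cl_extensive: "U \<subseteq> X \<Longrightarrow> U \<subseteq> cl X R U"
  unfolding cl_def by blast

lemma cl_mono: "U \<subseteq> V \<Longrightarrow> cl X R U \<subseteq> cl X R V"
  unfolding cl_def by blast

lemma cl_idem: "cl X R (cl X R U) \<subseteq> cl X R U"
  unfolding cl_def by blast

lemma cl_subset: "cl X R U \<subseteq> X"
  unfolding cl_def by blast

lemma propositionI: "U \<subseteq> X \<Longrightarrow> cl X R U \<subseteq> U \<Longrightarrow> U \<in> propositions X R"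
  using cl_extensive[of U X R] unfolding propositions_def by blast

lemma truth_set_proposition:
  assumes "is_model M"
  shows "truth_set M \<phi> \<in> propositions (states M) (rel M)"
proof (induction \<phi>)
  case (Var p)
  then show ?case using assms by (simp add: is_model_def)
next
  case Bot
  show ?case by (rule propositionI) (auto simp: box_def cl_def)
next
  case Top
  show ?case by (rule propositionI) (auto simp: cl_subset)
next
  case (Conj \<alpha> \<beta>)
  then show ?case
    using cl_mono[of "truth_set M \<alpha> \<inter> truth_set M \<beta>" "truth_set M \<alpha>" "states M" "rel M"]
      cl_mono[of "truth_set M \<alpha> \<inter> truth_set M \<beta>" "truth_set M \<beta>" "states M" "rel M"]
    by (intro propositionI) (auto simp: propositions_def)
next
  case (Disj \<alpha> \<beta>)
  show ?case by (rule propositionI) (simp_all add: cl_subset cl_idem)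
next
  case (Cond \<alpha> \<beta>)
  show ?case
  proof (rule propositionI)
    show "truth_set M (\<alpha> \<^bold>\<rightarrow> \<beta>) \<subseteq> states M" by (auto simp: cond_def)
    show "cl (states M) (rel M) (truth_set M (\<alpha> \<^bold>\<rightarrow> \<beta>)) \<subseteq> truth_set M (\<alpha> \<^bold>\<rightarrow> \<beta>)"
      by (simp add: cond_def cl_def) blast
  qed
qed

lemma truth_set_subset: "is_model M \<Longrightarrow> truth_set M \<phi> \<subseteq> states M"
  using truth_set_proposition[of M \<phi>] by (simp add: propositions_def)

lemma truth_set_closed: "is_model M \<Longrightarrow> cl (states M) (rel M) (truth_set M \<phi>) = truth_set M \<phi>"
  using truth_set_proposition[of M \<phi>] by (simp add: propositions_def)

lemma entails_singleton_iff:
  assumes "is_model M"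
  shows "entails {M} {\<alpha>} \<beta> \<longleftrightarrow> truth_set M \<alpha> \<subseteq> truth_set M \<beta>"
  using truth_set_subset[OF assms, of \<alpha>] by (auto simp: entails_def sat_def)

lemma derives_sound:
  assumes M: "is_model M"
    and S: "\<And>\<Gamma> \<phi>. (\<Gamma>, \<phi>) \<in> S \<Longrightarrow> entails {M} \<Gamma> \<phi>"
    and "derives S \<Gamma> \<phi>"
  shows "entails {M} \<Gamma> \<phi>"
  using \<open>derives S \<Gamma> \<phi>\<close>
proof induction
  case (DisjE \<phi> \<alpha> \<psi>)
  then show ?case
    using cl_mono[of "truth_set M \<phi> \<union> truth_set M \<psi>" "truth_set M \<alpha>" "states M" "rel M"]
    by (simp add: entails_singleton_iff[OF M] truth_set_closed[OF M])
next
  case (DisjI1 \<phi> \<psi>)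
  then show ?case
    using cl_extensive[of "truth_set M \<phi> \<union> truth_set M \<psi>" "states M" "rel M"]
    by (simp add: entails_singleton_iff[OF M] truth_set_subset[OF M])
next
  case (DisjI2 \<psi> \<phi>)
  then show ?case
    using cl_extensive[of "truth_set M \<phi> \<union> truth_set M \<psi>" "states M" "rel M"]
    by (simp add: entails_singleton_iff[OF M] truth_set_subset[OF M])
next
  case (BotE \<phi>)
  have "box (states M) (rel M) {} \<subseteq> cl (states M) (rel M) (truth_set M \<phi>)"
    by (auto simp: box_def cl_def)
  then show ?case by (simp add: entails_singleton_iff[OF M] truth_set_closed[OF M])
next
  case (TopCondE \<phi>)
  have "cond (states M) (rel M) (states M) (truth_set M \<phi>)
      \<subseteq> cl (states M) (rel M) (truth_set M \<phi>)"
    using M by (auto simp: cond_def cl_def is_model_def relational_frame_def)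
  then show ?case by (simp add: entails_singleton_iff[OF M] truth_set_closed[OF M])
next
  case (Con \<alpha> \<beta> \<psi>)
  then show ?case by (simp add: entails_singleton_iff[OF M] cond_def) blast
next
  case (ConjCond \<alpha> \<beta>)
  show ?case
    using truth_set_subset[OF M] by (auto simp: entails_singleton_iff[OF M] cond_def)
next
  case (Imp \<alpha> \<beta> \<phi>)
  then show ?case by (simp add: entails_singleton_iff[OF M] cond_def) blast
next
  case (Rep \<alpha> \<alpha>' \<beta>)
  then have "truth_set M \<alpha> = truth_set M \<alpha>'" by (simp add: entails_singleton_iff[OF M])
  then show ?case by (simp add: entails_singleton_iff[OF M])
qed (use S in \<open>auto simp: entails_def sat_def\<close>)

text \<open>
  By reflexivity a state is itself the witness that \<open>cond\<close> asks for, and no state satisfies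
  \<open>\<^bold>\<bottom>\<close>.
\<close>

lemma CondId_Exp_sound:
  assumes "M \<in> C_T" and "(\<Gamma>, \<phi>) \<in> CondId \<union> Exp"
  shows "entails {M} \<Gamma> \<phi>"
proof -
  have refl: "(x, x) \<in> rel M" if "x \<in> states M" for x
    using assms(1) that by (auto simp: C_T_def refl_on_def)
  have sub: "truth_set M \<alpha> \<subseteq> states M" for \<alpha>
    using assms(1) truth_set_subset[of M] by (simp add: C_T_def)
  from assms(2) consider \<alpha> where "\<Gamma> = {}" "\<phi> = \<alpha> \<^bold>\<rightarrow> \<alpha>" | \<alpha> where "\<Gamma> = {\<alpha>, \<^bold>\<not> \<alpha>}" "\<phi> = \<^bold>\<bottom>"
    by (auto simp: CondId_def Exp_def)
  then show ?thesis
  proof cases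
    case 1
    then show ?thesis using refl sub[THEN subsetD] by (simp add: entails_def sat_def cond_def) blast
  next
    case 2
    then show ?thesis using refl by (simp add: entails_def sat_def cond_def box_def) blast
  qed
qed

text \<open>
  A state that prerefines \<open>x\<close> belongs to every proposition that contains \<open>x\<close>, because the closure
  operator looks only at the predecessors of a state.
\<close>

lemma NegNegI_sound:
  assumes "M \<in> C_F" and "(\<Gamma>, \<phi>) \<in> NegNegI"
  shows "entails {M} \<Gamma> \<phi>"
proof -
  let ?X = "states M" and ?R = "rel M"
  have M: "is_model M" and R: "?R \<subseteq> ?X \<times> ?X" and refl: "\<And>x. x \<in> ?X \<Longrightarrow> (x, x) \<in> ?R"
    and ps: "pseudo_symmetric ?X ?R"
    using assms(1) by (auto simp: C_F_def F_frame_def relational_frame_def refl_on_def)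
  from assms(2) obtain \<alpha> where \<Gamma>: "\<Gamma> = {\<alpha>}" and \<phi>: "\<phi> = \<^bold>\<not> \<^bold>\<not> \<alpha>"
    by (auto simp: NegNegI_def)
  have "y \<notin> truth_set M (\<^bold>\<not> \<alpha>)" if x: "x \<in> truth_set M \<alpha>" and yx: "(y, x) \<in> ?R" for x y
  proof
    assume y: "y \<in> truth_set M (\<^bold>\<not> \<alpha>)"
    obtain z where zy: "(z, y) \<in> ?R" and pre: "prerefines ?R z x"
      using ps R yx unfolding pseudo_symmetric_def by blast
    have "x \<in> cl ?X ?R (truth_set M \<alpha>)" using x truth_set_closed[OF M] by blast
    then have "z \<in> cl ?X ?R (truth_set M \<alpha>)"
      using pre zy R by (auto simp: prerefines_def cl_def)
    then have "z \<in> truth_set M \<alpha>" using truth_set_closed[OF M] by blast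
    then show False using y zy refl by (auto simp: cond_def box_def)
  qed
  then have "truth_set M \<alpha> \<subseteq> truth_set M (\<^bold>\<not> \<^bold>\<not> \<alpha>)"
    using truth_set_subset[OF M, of \<alpha>] unfolding truth_set.simps(6)[of M "\<^bold>\<not> \<alpha>"] cond_def by blast
  then show ?thesis by (simp add: \<Gamma> \<phi> entails_singleton_iff[OF M])
qed

lemma C_F_subset_C_T: "C_F \<subseteq> C_T"
  by (auto simp: C_F_def C_T_def F_frame_def)

lemma entails_iff_singletons: "entails C \<Gamma> \<phi> \<longleftrightarrow> (\<forall>M\<in>C. entails {M} \<Gamma> \<phi>)"
  by (simp add: entails_def)

lemma derives_T_sound:
  fixes \<Gamma> :: "'p form set"
  assumes "\<Gamma> \<turnstile>\<^sub>T \<phi>"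
  shows "entails (C_T :: ('x, 'p) model set) \<Gamma> \<phi>"
proof (subst entails_iff_singletons, intro ballI)
  fix M :: "('x, 'p) model" assume M: "M \<in> C_T"
  then have "is_model M" by (simp add: C_T_def)
  then show "entails {M} \<Gamma> \<phi>"
    using derives_sound CondId_Exp_sound[OF M] assms unfolding derives_T_def by blast
qed

lemma derives_F_sound:
  fixes \<Gamma> :: "'p form set"
  assumes "\<Gamma> \<turnstile>\<^sub>F \<phi>"
  shows "entails (C_F :: ('x, 'p) model set) \<Gamma> \<phi>"
proof (subst entails_iff_singletons, intro ballI)
  fix M :: "('x, 'p) model" assume M: "M \<in> C_F"
  have "entails {M} \<Delta> \<psi>" if "(\<Delta>, \<psi>) \<in> CondId \<union> Exp \<union> NegNegI" for \<Delta> \<psi>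
    using that M C_F_subset_C_T CondId_Exp_sound NegNegI_sound by blast
  moreover have "is_model M" using M by (simp add: C_F_def)
  ultimately show "entails {M} \<Gamma> \<phi>"
    using derives_sound assms unfolding derives_F_def by blast
qed

section \<open>Derivability\<close>

locale T_system =
  fixes S :: "('p form set \<times> 'p form) set"
  assumes CondId: "CondId \<subseteq> S" and Exp: "Exp \<subseteq> S"
begin

abbreviation derivable :: "'p form set \<Rightarrow> 'p form \<Rightarrow> bool"  (infix "\<turnstile>" 50)
  where "\<Gamma> \<turnstile> \<phi> \<equiv> derives S \<Gamma> \<phi>"

lemma member: "\<phi> \<in> \<Gamma> \<Longrightarrow> \<Gamma> \<turnstile> \<phi>"
  using derives.A[of S \<Gamma> \<phi>] by (simp add: insert_absorb)

lemma trans: "\<Gamma> \<turnstile> \<alpha> \<Longrightarrow> {\<alpha>} \<turnstile> \<beta> \<Longrightarrow> \<Gamma> \<turnstile> \<beta>"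
  using derives.Cut[of S "{}" \<alpha> \<beta> \<Gamma>] by simp

lemma weaken:
  assumes "\<Gamma> \<turnstile> \<phi>"
  shows "\<Gamma> \<union> \<Delta> \<turnstile> \<phi>"
  using derives.Cut[OF derives.A assms, of \<Delta>] by (simp add: Un_commute)

lemma cut2:
  assumes "\<Gamma> \<turnstile> \<alpha>" "\<Gamma> \<turnstile> \<beta>" "{\<alpha>, \<beta>} \<turnstile> \<gamma>"
  shows "\<Gamma> \<turnstile> \<gamma>"
proof -
  have "{\<alpha>} \<union> \<Gamma> \<turnstile> \<gamma>"
    by (rule derives.Cut[OF _ assms(2)]) (use assms(3) in \<open>simp add: insert_commute\<close>)
  then have "\<Gamma> \<union> {\<alpha>} \<turnstile> \<gamma>" by simp
  from derives.Cut[OF this assms(1)] show ?thesis by simp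
qed

lemma conj_iff: "\<Gamma> \<turnstile> \<alpha> \<^bold>\<and> \<beta> \<longleftrightarrow> \<Gamma> \<turnstile> \<alpha> \<and> \<Gamma> \<turnstile> \<beta>"
  using cut2[OF _ _ derives.ConjI] trans derives.ConjE1 derives.ConjE2 by blast

lemma bot_imp: "\<Gamma> \<turnstile> \<^bold>\<bottom> \<Longrightarrow> \<Gamma> \<turnstile> \<phi>"
  using trans derives.BotE by blast

lemma top: "\<Gamma> \<turnstile> \<^bold>\<top>"
  using weaken[OF derives.TopI] by auto

lemma cond_refl: "\<Gamma> \<turnstile> \<alpha> \<^bold>\<rightarrow> \<alpha>"
proof -
  have "{} \<turnstile> \<alpha> \<^bold>\<rightarrow> \<alpha>" using CondId by (auto simp: CondId_def intro: derives.extra)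
  then show ?thesis using weaken[of "{}" _ \<Gamma>] by simp
qed

lemma contradiction: "\<Gamma> \<turnstile> \<alpha> \<Longrightarrow> \<Gamma> \<turnstile> \<^bold>\<not> \<alpha> \<Longrightarrow> \<Gamma> \<turnstile> \<^bold>\<bottom>"
proof -
  have "{\<alpha>, \<^bold>\<not> \<alpha>} \<turnstile> \<^bold>\<bottom>" using Exp by (auto simp: Exp_def intro: derives.extra)
  then show "\<Gamma> \<turnstile> \<alpha> \<Longrightarrow> \<Gamma> \<turnstile> \<^bold>\<not> \<alpha> \<Longrightarrow> \<Gamma> \<turnstile> \<^bold>\<bottom>" using cut2 by blast
qed

lemma cond_mono: "{\<alpha> \<^bold>\<and> \<beta>} \<turnstile> \<psi> \<Longrightarrow> \<Gamma> \<turnstile> \<alpha> \<^bold>\<rightarrow> \<beta> \<Longrightarrow> \<Gamma> \<turnstile> \<alpha> \<^bold>\<rightarrow> \<psi>"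
  using trans derives.Con by blast

lemma cond_antecedent:
  assumes "{\<alpha>} \<turnstile> \<alpha>'" "{\<alpha>'} \<turnstile> \<alpha>" "\<Gamma> \<turnstile> \<alpha> \<^bold>\<rightarrow> \<beta>"
  shows "\<Gamma> \<turnstile> \<alpha>' \<^bold>\<rightarrow> \<beta>"
  using trans[OF assms(3) derives.Rep[OF assms(1,2)]] .

text \<open>
  The rule \<open>Imp\<close> discharges an outer antecedent \<open>\<phi>\<close> that the inner one implies, since then
  \<open>\<phi> \<^bold>\<and> \<alpha>\<close> and \<open>\<alpha>\<close> are interderivable.
\<close>

lemma cond_cond_imp:
  assumes "{\<alpha>} \<turnstile> \<phi>" "\<Gamma> \<turnstile> \<phi> \<^bold>\<rightarrow> (\<alpha> \<^bold>\<rightarrow> \<beta>)"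
  shows "\<Gamma> \<turnstile> \<alpha> \<^bold>\<rightarrow> \<beta>"
proof -
  have "{\<alpha> \<^bold>\<and> \<beta>} \<turnstile> \<phi>" using trans[OF derives.ConjE1 assms(1)] .
  then have "\<Gamma> \<turnstile> (\<phi> \<^bold>\<and> \<alpha>) \<^bold>\<rightarrow> \<beta>" using trans[OF assms(2) derives.Imp] by blast
  moreover have "{\<alpha>} \<turnstile> \<phi> \<^bold>\<and> \<alpha>" using assms(1) by (simp add: conj_iff member)
  ultimately show ?thesis using cond_antecedent derives.ConjE2 by blast
qed

lemma top_cond_iff: "\<Gamma> \<turnstile> \<^bold>\<top> \<^bold>\<rightarrow> \<phi> \<longleftrightarrow> \<Gamma> \<turnstile> \<phi>"
proof
  assume "\<Gamma> \<turnstile> \<phi>"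
  then have "\<Gamma> \<turnstile> \<^bold>\<top> \<^bold>\<and> \<phi>" by (simp add: conj_iff top)
  then show "\<Gamma> \<turnstile> \<^bold>\<top> \<^bold>\<rightarrow> \<phi>" using trans derives.ConjCond by blast
qed (use trans derives.TopCondE in blast)

text \<open>
  Only a conditional that is a theorem follows from its own antecedent, so excluding the
  incoherent pairs among \<open>({\<alpha>}, {\<alpha> \<^bold>\<rightarrow> \<beta>})\<close> costs no counterexample: weaken the consequent of
  \<open>\<alpha> \<^bold>\<rightarrow> \<alpha>\<close> to \<open>\<alpha> \<^bold>\<rightarrow> \<beta>\<close> and absorb the repeated antecedent.
\<close>

lemma cond_valid:
  assumes "{\<alpha>} \<turnstile> \<alpha> \<^bold>\<rightarrow> \<beta>"
  shows "\<Gamma> \<turnstile> \<alpha> \<^bold>\<rightarrow> \<beta>"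
proof -
  have "{\<alpha> \<^bold>\<and> \<alpha>} \<turnstile> \<alpha> \<^bold>\<rightarrow> \<beta>" using trans[OF derives.ConjE1 assms] .
  from cond_mono[OF this cond_refl] have "\<Gamma> \<turnstile> \<alpha> \<^bold>\<rightarrow> (\<alpha> \<^bold>\<rightarrow> \<beta>)" .
  then show ?thesis by (rule cond_cond_imp[OF member[OF singletonI]])
qed

text \<open>
  Conditionals are not antitone in the antecedent in general, but negations are, because \<open>\<^bold>\<bottom>\<close>
  implies \<open>\<^bold>\<not> \<alpha>\<close>: the negation \<open>\<^bold>\<not> \<beta>\<close> yields \<open>\<beta> \<^bold>\<rightarrow> \<^bold>\<not> \<alpha>\<close>, from which \<open>\<beta>\<close> can be absorbed.
\<close>

lemma contraposition:
  assumes "{\<alpha>} \<turnstile> \<beta>" "\<Gamma> \<turnstile> \<^bold>\<not> \<beta>"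
  shows "\<Gamma> \<turnstile> \<^bold>\<not> \<alpha>"
proof -
  have "{\<beta> \<^bold>\<and> \<^bold>\<bottom>} \<turnstile> \<^bold>\<not> \<alpha>" using trans[OF derives.ConjE2 derives.BotE] .
  from cond_mono[OF this assms(2)] show ?thesis by (rule cond_cond_imp[OF assms(1)])
qed

section \<open>The canonical model\<close>

text \<open>
  The last two clauses are what the clauses of the truth lemma for \<open>\<^bold>\<or>\<close> and \<open>\<^bold>\<rightarrow>\<close> demand of a state.
  The set \<open>J\<close> stands for the ideal of all formulas that imply some member of it.
\<close>

definition coherent :: "'p form set \<times> 'p form set \<Rightarrow> bool"
  where "coherent s \<longleftrightarrow> (case s of (G, J) \<Rightarrow>
    J \<noteq> {} \<and>
    (\<forall>y\<in>J. \<not> G \<turnstile> y) \<and>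
    (\<forall>y\<in>J. \<forall>y'\<in>J. \<exists>w\<in>J. {y} \<turnstile> w \<and> {y'} \<turnstile> w) \<and>
    (\<forall>\<alpha> \<beta>. \<forall>y\<in>J. G \<turnstile> \<alpha> \<longrightarrow> {\<alpha> \<^bold>\<and> \<beta>} \<turnstile> y \<longrightarrow> (\<exists>y'\<in>J. {\<alpha> \<^bold>\<rightarrow> \<beta>} \<turnstile> y')))"

definition cond_state :: "'p form \<Rightarrow> 'p form \<Rightarrow> 'p form set \<times> 'p form set"
  where "cond_state \<alpha> \<beta> = ({\<alpha>}, {\<alpha> \<^bold>\<rightarrow> \<beta>})"

definition neg_state :: "'p form set \<Rightarrow> 'p form set \<times> 'p form set"
  where "neg_state G = (G, {\<^bold>\<not> \<alpha> | \<alpha>. G \<turnstile> \<alpha>})"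

lemma coherent_cond_state:
  assumes "\<not> {\<alpha>} \<turnstile> \<alpha> \<^bold>\<rightarrow> \<beta>"
  shows "coherent (cond_state \<alpha> \<beta>)"
proof -
  have "{\<gamma> \<^bold>\<rightarrow> \<delta>} \<turnstile> \<alpha> \<^bold>\<rightarrow> \<beta>" if "{\<alpha>} \<turnstile> \<gamma>" "{\<gamma> \<^bold>\<and> \<delta>} \<turnstile> \<alpha> \<^bold>\<rightarrow> \<beta>" for \<gamma> \<delta>
    using cond_cond_imp[OF that(1) cond_mono[OF that(2) member]] by simp
  then show ?thesis using assms by (auto simp: coherent_def cond_state_def member)
qed

text \<open>
  Two rejected formulas \<open>\<^bold>\<not> \<alpha>\<close> and \<open>\<^bold>\<not> \<beta>\<close> lie below the rejected \<open>\<^bold>\<not> (\<alpha> \<^bold>\<and> \<beta>)\<close>. If \<open>\<alpha> \<^bold>\<and> \<beta>\<close> implies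
  \<open>\<^bold>\<not> \<gamma>\<close>, then \<open>\<alpha> \<^bold>\<rightarrow> \<beta>\<close> implies \<open>\<alpha> \<^bold>\<rightarrow> (\<gamma> \<^bold>\<rightarrow> \<^bold>\<bottom>)\<close>, hence \<open>\<^bold>\<not> (\<alpha> \<^bold>\<and> \<gamma>)\<close> by \<open>Imp\<close>, whose side
  condition holds because the inner consequent is \<open>\<^bold>\<bottom>\<close>.
\<close>

lemma coherent_neg_state:
  assumes "\<not> G \<turnstile> \<^bold>\<bottom>"
  shows "coherent (neg_state G)"
proof -
  have directed: "\<exists>w. G \<turnstile> w \<and> {\<^bold>\<not> \<alpha>} \<turnstile> \<^bold>\<not> w \<and> {\<^bold>\<not> \<beta>} \<turnstile> \<^bold>\<not> w"
    if "G \<turnstile> \<alpha>" "G \<turnstile> \<beta>" for \<alpha> \<beta>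
  proof (intro exI[of _ "\<alpha> \<^bold>\<and> \<beta>"] conjI)
    show "{\<^bold>\<not> \<alpha>} \<turnstile> \<^bold>\<not> (\<alpha> \<^bold>\<and> \<beta>)" using contraposition[OF derives.ConjE1 member] by simp
    show "{\<^bold>\<not> \<beta>} \<turnstile> \<^bold>\<not> (\<alpha> \<^bold>\<and> \<beta>)" using contraposition[OF derives.ConjE2 member] by simp
  qed (use that in \<open>simp add: conj_iff\<close>)
  have cond: "\<exists>w. G \<turnstile> w \<and> {\<alpha> \<^bold>\<rightarrow> \<beta>} \<turnstile> \<^bold>\<not> w"
    if "G \<turnstile> \<gamma>" "G \<turnstile> \<alpha>" "{\<alpha> \<^bold>\<and> \<beta>} \<turnstile> \<^bold>\<not> \<gamma>" for \<alpha> \<beta> \<gamma>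
  proof (intro exI[of _ "\<alpha> \<^bold>\<and> \<gamma>"] conjI)
    show "G \<turnstile> \<alpha> \<^bold>\<and> \<gamma>" using that by (simp add: conj_iff)
    have "{\<alpha> \<^bold>\<rightarrow> \<beta>} \<turnstile> \<alpha> \<^bold>\<rightarrow> \<^bold>\<not> \<gamma>" using cond_mono[OF that(3) member] by simp
    moreover have "{\<gamma> \<^bold>\<and> \<^bold>\<bottom>} \<turnstile> \<alpha>" using trans[OF derives.ConjE2 derives.BotE] .
    ultimately show "{\<alpha> \<^bold>\<rightarrow> \<beta>} \<turnstile> \<^bold>\<not> (\<alpha> \<^bold>\<and> \<gamma>)" using trans derives.Imp by blast
  qed
  show ?thesis
    unfolding coherent_def neg_state_def prod.case
  proof (intro conjI allI ballI impI)
    show "{\<^bold>\<not> \<alpha> | \<alpha>. G \<turnstile> \<alpha>} \<noteq> {}" using top by blast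
  next
    fix y assume "y \<in> {\<^bold>\<not> \<alpha> | \<alpha>. G \<turnstile> \<alpha>}"
    then show "\<not> G \<turnstile> y" using assms contradiction by blast
  next
    fix y y' assume "y \<in> {\<^bold>\<not> \<alpha> | \<alpha>. G \<turnstile> \<alpha>}" "y' \<in> {\<^bold>\<not> \<alpha> | \<alpha>. G \<turnstile> \<alpha>}"
    then show "\<exists>w\<in>{\<^bold>\<not> \<alpha> | \<alpha>. G \<turnstile> \<alpha>}. {y} \<turnstile> w \<and> {y'} \<turnstile> w" using directed by blast
  next
    fix \<alpha> \<beta> y assume "y \<in> {\<^bold>\<not> \<alpha> | \<alpha>. G \<turnstile> \<alpha>}" "G \<turnstile> \<alpha>" "{\<alpha> \<^bold>\<and> \<beta>} \<turnstile> y"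
    then show "\<exists>y'\<in>{\<^bold>\<not> \<alpha> | \<alpha>. G \<turnstile> \<alpha>}. {\<alpha> \<^bold>\<rightarrow> \<beta>} \<turnstile> y'" using cond by blast
  qed
qed

end

text \<open>
  The states are points of an arbitrary type that carry pairs as labels, so that a single
  infinite type can host the model; the labelling need not be injective.
\<close>

locale canonical_labelling = T_system S for S :: "('p form set \<times> 'p form) set" +
  fixes label :: "'x \<Rightarrow> 'p form set \<times> 'p form set"
  assumes coherent_label: "coherent (label s)"
    and cond_state_label: "\<not> {\<alpha>} \<turnstile> \<alpha> \<^bold>\<rightarrow> \<beta> \<Longrightarrow> cond_state \<alpha> \<beta> \<in> range label"
    and neg_state_label: "neg_state (fst (label s)) \<in> range label"
begin

definition accepts :: "'x \<Rightarrow> 'p form \<Rightarrow> bool"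
  where "accepts s \<phi> \<longleftrightarrow> fst (label s) \<turnstile> \<phi>"

definition open_to :: "'x rel"
  where "open_to = {(t, s). \<forall>y\<in>snd (label t). \<not> accepts s y}"

definition canonical_model :: "('x, 'p) model"
  where "canonical_model = \<lparr>states = UNIV, rel = open_to, val = \<lambda>p. {s. accepts s (Var p)}\<rparr>"

lemma open_to_refl: "(s, s) \<in> open_to"
  using coherent_label[of s] by (auto simp: open_to_def accepts_def coherent_def split: prod.splits)

lemma rejected_directed:
  "y \<in> snd (label s) \<Longrightarrow> y' \<in> snd (label s) \<Longrightarrow> \<exists>w\<in>snd (label s). {y} \<turnstile> w \<and> {y'} \<turnstile> w"
  using coherent_label[of s] by (auto simp: coherent_def split: prod.splits)

lemma rejected_cond:
  "y \<in> snd (label s) \<Longrightarrow> accepts s \<alpha> \<Longrightarrow> {\<alpha> \<^bold>\<and> \<beta>} \<turnstile> y \<Longrightarrow> \<exists>y'\<in>snd (label s). {\<alpha> \<^bold>\<rightarrow> \<beta>} \<turnstile> y'"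
  using coherent_label[of s] unfolding coherent_def accepts_def by (cases "label s") (simp, blast)

lemma rejected_nonempty: "snd (label s) \<noteq> {}"
  using coherent_label[of s] by (auto simp: coherent_def split: prod.splits)

lemma accepts_trans: "accepts s \<alpha> \<Longrightarrow> {\<alpha>} \<turnstile> \<beta> \<Longrightarrow> accepts s \<beta>"
  by (auto simp: accepts_def intro: trans)

lemma accepts_consistent: "\<not> accepts s \<^bold>\<bottom>"
  using open_to_refl[of s] rejected_nonempty[of s] bot_imp
  by (auto simp: open_to_def accepts_def)

lemma state_of_formula:
  assumes "\<not> {\<alpha>} \<turnstile> \<^bold>\<bottom>"
  obtains s where "fst (label s) = {\<alpha>}"
proof -
  have "\<not> {\<alpha>} \<turnstile> \<^bold>\<not> \<alpha>" using assms contradiction member by blast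
  from cond_state_label[OF this] obtain s where "label s = cond_state \<alpha> \<^bold>\<bottom>" by auto
  then show ?thesis using that[of s] by (simp add: cond_state_def)
qed

text \<open>
  If what \<open>t\<close> rejects does not include any consequence of \<open>\<alpha>\<close>, then any state whose accepted
  formulas are just the consequences of \<open>\<alpha>\<close> will do.
\<close>

lemma open_to_accepting:
  assumes "\<forall>y\<in>snd (label t). \<not> {\<alpha>} \<turnstile> y"
  obtains s where "(t, s) \<in> open_to" "accepts s \<alpha>"
proof -
  have "\<not> {\<alpha>} \<turnstile> \<^bold>\<bottom>" using assms rejected_nonempty[of t] bot_imp by blast
  from state_of_formula[OF this] obtain s where "fst (label s) = {\<alpha>}" .
  with assms that[of s] show ?thesis by (simp add: open_to_def accepts_def member)
qed

text \<open>
  The state labelled \<open>({\<^bold>\<top>}, {\<^bold>\<top> \<^bold>\<rightarrow> \<phi>})\<close> in effect rejects exactly what implies \<open>\<phi>\<close>, so it is open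
  precisely to the states that do not accept \<open>\<phi>\<close>.
\<close>

lemma unaccepted_witness:
  assumes "\<not> accepts s \<phi>"
  obtains t where "(t, s) \<in> open_to" "\<And>z. (t, z) \<in> open_to \<Longrightarrow> \<not> accepts z \<phi>"
proof -
  have "\<not> {\<^bold>\<top>} \<turnstile> \<^bold>\<top> \<^bold>\<rightarrow> \<phi>"
    using assms trans[OF top] by (auto simp: accepts_def top_cond_iff)
  from cond_state_label[OF this] obtain t where "label t = cond_state \<^bold>\<top> \<phi>" by auto
  with assms that[of t] show ?thesis
    by (simp add: cond_state_def open_to_def accepts_def top_cond_iff)
qed

lemma cl_union_accepts:
  "cl UNIV open_to ({s. accepts s \<alpha>} \<union> {s. accepts s \<beta>}) = {s. accepts s (\<alpha> \<^bold>\<or> \<beta>)}"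
proof (intro equalityI subsetI CollectI)
  fix s assume s: "s \<in> cl UNIV open_to ({s. accepts s \<alpha>} \<union> {s. accepts s \<beta>})"
  show "accepts s (\<alpha> \<^bold>\<or> \<beta>)"
  proof (rule ccontr)
    assume "\<not> accepts s (\<alpha> \<^bold>\<or> \<beta>)"
    then obtain t where "(t, s) \<in> open_to"
      and t: "\<And>z. (t, z) \<in> open_to \<Longrightarrow> \<not> accepts z (\<alpha> \<^bold>\<or> \<beta>)"
      using unaccepted_witness by blast
    then obtain z where "(t, z) \<in> open_to" "accepts z \<alpha> \<or> accepts z \<beta>"
      using s by (auto simp: cl_def)
    then show False using t accepts_trans derives.DisjI1 derives.DisjI2 by blast
  qed
next
  fix s assume "s \<in> {s. accepts s (\<alpha> \<^bold>\<or> \<beta>)}"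
  then have s: "accepts s (\<alpha> \<^bold>\<or> \<beta>)" by simp
  have "\<exists>z. (t, z) \<in> open_to \<and> (accepts z \<alpha> \<or> accepts z \<beta>)" if ts: "(t, s) \<in> open_to" for t
  proof (rule ccontr)
    assume no: "\<not> ?thesis"
    obtain y where y: "y \<in> snd (label t)" "{\<alpha>} \<turnstile> y" using no open_to_accepting by blast
    obtain y' where y': "y' \<in> snd (label t)" "{\<beta>} \<turnstile> y'" using no open_to_accepting by blast
    obtain w where w: "w \<in> snd (label t)" "{y} \<turnstile> w" "{y'} \<turnstile> w"
      using rejected_directed y(1) y'(1) by blast
    have "{\<alpha> \<^bold>\<or> \<beta>} \<turnstile> w" using trans[OF y(2) w(2)] trans[OF y'(2) w(3)] by (rule derives.DisjE)
    then show False using accepts_trans[OF s] w(1) ts by (auto simp: open_to_def)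
  qed
  then show "s \<in> cl UNIV open_to ({s. accepts s \<alpha>} \<union> {s. accepts s \<beta>})" by (auto simp: cl_def)
qed

text \<open>This is what makes the valuation of the canonical model take propositions as values.\<close>

lemma cl_accepts: "cl UNIV open_to {s. accepts s \<alpha>} = {s. accepts s \<alpha>}"
proof -
  have "accepts s (\<alpha> \<^bold>\<or> \<alpha>) \<longleftrightarrow> accepts s \<alpha>" for s
    using accepts_trans derives.DisjI1 derives.DisjE[OF member member] by blast
  then show ?thesis using cl_union_accepts[of \<alpha> \<alpha>] by simp
qed

lemma cond_accepts:
  "cond UNIV open_to {s. accepts s \<alpha>} {s. accepts s \<beta>} = {s. accepts s (\<alpha> \<^bold>\<rightarrow> \<beta>)}"
proof (intro equalityI subsetI CollectI)
  fix s assume s: "s \<in> cond UNIV open_to {s. accepts s \<alpha>} {s. accepts s \<beta>}"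
  show "accepts s (\<alpha> \<^bold>\<rightarrow> \<beta>)"
  proof (rule ccontr)
    assume no: "\<not> accepts s (\<alpha> \<^bold>\<rightarrow> \<beta>)"
    then have "\<not> {\<alpha>} \<turnstile> \<alpha> \<^bold>\<rightarrow> \<beta>" using cond_valid by (auto simp: accepts_def)
    from cond_state_label[OF this] obtain t where t: "label t = cond_state \<alpha> \<beta>" by auto
    then have "(t, s) \<in> open_to" "accepts t \<alpha>"
      using no by (auto simp: open_to_def cond_state_def accepts_def member)
    then obtain z where "(t, z) \<in> open_to" "accepts z \<alpha>" "accepts z \<beta>"
      using s by (auto simp: cond_def)
    moreover have "accepts z (\<alpha> \<^bold>\<rightarrow> \<beta>)"
      using calculation(2,3) trans[OF _ derives.ConjCond] by (auto simp: accepts_def conj_iff)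
    ultimately show False using t by (auto simp: open_to_def cond_state_def)
  qed
next
  fix s assume "s \<in> {s. accepts s (\<alpha> \<^bold>\<rightarrow> \<beta>)}"
  then have s: "accepts s (\<alpha> \<^bold>\<rightarrow> \<beta>)" by simp
  have "\<exists>z. (t, z) \<in> open_to \<and> accepts z \<alpha> \<and> accepts z \<beta>"
    if ts: "(t, s) \<in> open_to" and t: "accepts t \<alpha>" for t
  proof -
    have "\<forall>y\<in>snd (label t). \<not> {\<alpha> \<^bold>\<and> \<beta>} \<turnstile> y"
    proof (intro ballI notI)
      fix y assume "y \<in> snd (label t)" "{\<alpha> \<^bold>\<and> \<beta>} \<turnstile> y"
      from rejected_cond[OF this(1) t this(2)]
      obtain y' where "y' \<in> snd (label t)" "{\<alpha> \<^bold>\<rightarrow> \<beta>} \<turnstile> y'" by blast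
      then show False using ts accepts_trans[OF s] by (auto simp: open_to_def)
    qed
    then obtain z where "(t, z) \<in> open_to" "accepts z (\<alpha> \<^bold>\<and> \<beta>)" using open_to_accepting by blast
    then show ?thesis by (auto simp: accepts_def conj_iff)
  qed
  then show "s \<in> cond UNIV open_to {s. accepts s \<alpha>} {s. accepts s \<beta>}" by (auto simp: cond_def)
qed

lemma truth_lemma: "truth_set canonical_model \<phi> = {s. accepts s \<phi>}"
proof (induction \<phi>)
  case Bot
  show ?case using open_to_refl accepts_consistent by (auto simp: canonical_model_def box_def)
next
  case (Disj \<alpha> \<beta>)
  then show ?case using cl_union_accepts by (simp add: canonical_model_def)
next
  case (Cond \<alpha> \<beta>)
  then show ?case using cond_accepts by (simp add: canonical_model_def)
qed (auto simp: canonical_model_def accepts_def conj_iff top)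

lemma canonical_model_C_T: "canonical_model \<in> C_T"
  using open_to_refl cl_accepts
  by (auto simp: C_T_def is_model_def relational_frame_def propositions_def canonical_model_def
      intro: refl_onI)

text \<open>
  If \<open>t \<lhd> s\<close>, let \<open>u\<close> accept the same formulas as \<open>s\<close> and reject their negations. Then \<open>u\<close>
  prerefines \<open>s\<close>, as \<open>z \<lhd> s\<close> depends only on what \<open>s\<close> accepts. Moreover \<open>u \<lhd> t\<close>: if \<open>t\<close> accepted
  \<open>\<^bold>\<not> \<alpha>\<close> for some \<open>\<alpha>\<close> that \<open>s\<close> accepts, then coherence would make \<open>t\<close> reject \<open>\<^bold>\<not> \<^bold>\<not> \<alpha>\<close>, which \<open>s\<close>
  accepts by \<open>NegNegI\<close>.
\<close>

lemma canonical_model_C_F: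
  assumes "NegNegI \<subseteq> S"
  shows "canonical_model \<in> C_F"
proof -
  have "\<exists>u. (u, t) \<in> open_to \<and> prerefines open_to u s" if ts: "(t, s) \<in> open_to" for t s
  proof -
    obtain u where u: "label u = neg_state (fst (label s))"
      using neg_state_label[of s] by (metis imageE)
    have "\<not> accepts t (\<^bold>\<not> \<alpha>)" if "accepts s \<alpha>" for \<alpha>
    proof
      assume t: "accepts t (\<^bold>\<not> \<alpha>)"
      obtain y where "y \<in> snd (label t)" using rejected_nonempty by blast
      moreover have "{\<^bold>\<not> \<alpha> \<^bold>\<and> \<^bold>\<bottom>} \<turnstile> y" using trans[OF derives.ConjE2 derives.BotE] .
      ultimately obtain y' where y': "y' \<in> snd (label t)" "{\<^bold>\<not> \<^bold>\<not> \<alpha>} \<turnstile> y'"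
        using rejected_cond[OF _ t] by blast
      have "{\<alpha>} \<turnstile> \<^bold>\<not> \<^bold>\<not> \<alpha>" using assms by (auto simp: NegNegI_def intro: derives.extra)
      then have "accepts s y'" using that y'(2) accepts_trans by blast
      then show False using ts y'(1) by (auto simp: open_to_def)
    qed
    then have "(u, t) \<in> open_to" using u by (auto simp: open_to_def neg_state_def accepts_def)
    moreover have "prerefines open_to u s"
      using u by (auto simp: prerefines_def open_to_def neg_state_def accepts_def)
    ultimately show ?thesis by blast
  qed
  then show ?thesis
    using canonical_model_C_T
    by (auto simp: C_F_def C_T_def F_frame_def is_model_def pseudo_symmetric_def
        canonical_model_def)
qed

end

section \<open>Completeness\<close>

instance form :: (countable) countable
  by countable_datatype

lemma surjection_onto_countable:
  assumes "infinite (UNIV :: 'x set)" "countable A" "A \<noteq> {}"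
  obtains f :: "'x \<Rightarrow> 'a" where "range f = A"
proof -
  obtain e :: "nat \<Rightarrow> 'x" where e: "inj e"
    using assms(1) infinite_countable_subset by blast
  have "range (from_nat_into A \<circ> inv e) = from_nat_into A ` range (inv e)" by (simp add: image_comp)
  also have "range (inv e) = UNIV" using e by (simp add: inj_imp_surj_inv)
  finally show ?thesis using that range_from_nat_into[OF assms(3,2)] by simp
qed

text \<open>
  The labels are all coherent pairs \<open>cond_state \<alpha> \<beta>\<close>, and the pairs \<open>neg_state G\<close> for every
  consistent \<open>G\<close> that occurs as a first component: the singletons, and \<open>\<Gamma>\<close>, whose state refutes
  the entailment.
\<close>

lemma (in T_system) countermodel:
  fixes \<Gamma> :: "'p form set"
  assumes "infinite (UNIV :: 'x set)" and "countable (UNIV :: 'p form set)"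
    and "\<not> \<Gamma> \<turnstile> \<phi>"
  obtains M :: "('x, 'p) model" where "M \<in> C_T" "NegNegI \<subseteq> S \<longrightarrow> M \<in> C_F" "\<not> entails {M} \<Gamma> \<phi>"
proof -
  define A where "A = {cond_state \<alpha> \<beta> | \<alpha> \<beta>. \<not> {\<alpha>} \<turnstile> \<alpha> \<^bold>\<rightarrow> \<beta>}"
  define B where "B = {neg_state G | G. G \<in> insert \<Gamma> (range (\<lambda>\<alpha>. {\<alpha>})) \<and> \<not> G \<turnstile> \<^bold>\<bottom>}"
  have "A \<subseteq> case_prod cond_state ` (UNIV \<times> UNIV)" by (force simp: A_def)
  moreover have "countable (case_prod cond_state ` (UNIV \<times> UNIV))"
    using assms(2) by (intro countable_image countable_SIGMA) auto
  ultimately have "countable A" by (rule countable_subset)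
  moreover have "countable B"
    by (rule countable_subset[of _ "neg_state ` insert \<Gamma> (range (\<lambda>\<alpha>. {\<alpha>}))"])
      (use assms(2) in \<open>auto simp: B_def\<close>)
  moreover have \<Gamma>: "neg_state \<Gamma> \<in> B" using assms(3) bot_imp by (auto simp: B_def)
  ultimately obtain label :: "'x \<Rightarrow> _" where label: "range label = A \<union> B"
    using surjection_onto_countable[OF assms(1), of "A \<union> B"] by auto
  have coh: "coherent s" if "s \<in> A \<union> B" for s
    using that coherent_cond_state coherent_neg_state by (auto simp: A_def B_def)
  interpret canonical_labelling S label
  proof
    fix s
    have s: "label s \<in> A \<union> B" using label by blast
    then show "coherent (label s)" by (rule coh)
    have "fst (label s) \<in> insert \<Gamma> (range (\<lambda>\<alpha>. {\<alpha>}))"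
      using s by (auto simp: A_def B_def cond_state_def neg_state_def)
    moreover have "\<not> fst (label s) \<turnstile> \<^bold>\<bottom>"
      using coh[OF s] bot_imp by (auto simp: coherent_def split: prod.splits)
    ultimately show "neg_state (fst (label s)) \<in> range label" by (auto simp: label B_def)
  qed (auto simp: label A_def)
  obtain s where "label s = neg_state \<Gamma>" using \<Gamma> label by (metis UnI2 imageE)
  then have "fst (label s) = \<Gamma>" by (simp add: neg_state_def)
  moreover have "s \<in> states canonical_model" by (simp add: canonical_model_def)
  ultimately have "\<not> entails {canonical_model} \<Gamma> \<phi>"
    using assms(3) by (auto simp: entails_def sat_def truth_lemma accepts_def intro: member)
  then show ?thesis using that canonical_model_C_T canonical_model_C_F by blast
qed

theorem theorem5p12:
  fixes \<Gamma> :: "('p::countable) form set" and \<phi> :: "'p form"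
  assumes "infinite (UNIV :: 'x set)"
  shows "(\<Gamma> \<turnstile>\<^sub>T \<phi> \<longleftrightarrow> entails (C_T :: ('x, 'p) model set) \<Gamma> \<phi>) \<and>
         (\<Gamma> \<turnstile>\<^sub>F \<phi> \<longleftrightarrow> entails (C_F :: ('x, 'p) model set) \<Gamma> \<phi>)"
proof (intro conjI iffI)
  show "entails (C_T :: ('x, 'p) model set) \<Gamma> \<phi>" if "\<Gamma> \<turnstile>\<^sub>T \<phi>"
    using that by (rule derives_T_sound)
  show "entails (C_F :: ('x, 'p) model set) \<Gamma> \<phi>" if "\<Gamma> \<turnstile>\<^sub>F \<phi>"
    using that by (rule derives_F_sound)
  have countable: "countable (UNIV :: 'p form set)" by simp
  show "\<Gamma> \<turnstile>\<^sub>T \<phi>" if valid: "entails (C_T :: ('x, 'p) model set) \<Gamma> \<phi>"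
  proof (rule ccontr)
    interpret T_system "CondId \<union> Exp :: ('p form set \<times> 'p form) set" by unfold_locales auto
    assume "\<not> \<Gamma> \<turnstile>\<^sub>T \<phi>"
    then obtain M :: "('x, 'p) model" where "M \<in> C_T" "\<not> entails {M} \<Gamma> \<phi>"
      using countermodel[OF assms countable] unfolding derives_T_def by metis
    then show False using valid entails_iff_singletons by blast
  qed
  show "\<Gamma> \<turnstile>\<^sub>F \<phi>" if valid: "entails (C_F :: ('x, 'p) model set) \<Gamma> \<phi>"
  proof (rule ccontr)
    interpret T_system "CondId \<union> Exp \<union> NegNegI :: ('p form set \<times> 'p form) set"
      by unfold_locales auto
    assume "\<not> \<Gamma> \<turnstile>\<^sub>F \<phi>"
    then obtain M :: "('x, 'p) model" where "M \<in> C_F" "\<not> entails {M} \<Gamma> \<phi>"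
      using countermodel[OF assms countable] unfolding derives_F_def by (metis Un_upper2)
    then show False using valid entails_iff_singletons by blast
  qed
qed

end
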